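(* Let $S$ be a finite set and let $\mu\colon\mathscr P(S)\to\mathbf Z$ be an integer-valued submodular set function with base polytope $B_\mu\subset\mathbf R^S$. The polynomials $$I_\mu(\xi)=\sum_{\mathbf x\in B_\mu\cap\mathbf Z^S}\xi^{\bar\iota(\mathbf x)}\quad\text{and}\quad X_\mu(\eta)=\sum_{\mathbf x\in B_\mu\cap\mathbf Z^S}\eta^{\bar\varepsilon(\mathbf x)},$$ defined using a total order on $S$, do not depend on the chosen order.
   Context: $\mathscr P(S)$ is the power set of $S$. A set function $\mu$ is submodular if $\mu(U)+\mu(W)\ge\mu(U\cap W)+\mu(U\cup W)$ for all $U,W\subset S$. Its base polytope is $$B_\mu=\Bigl\{\mathbf x\in\mathbf R^S\Bigm|\sum_{s\in U}x_s\le\mu(U)\text{ for all }U\subset S,\ \sum_{s\in S}x_s=\mu(S)\Bigr\};$$ its elements are called bases. A base $\mathbf x\in B_\mu\cap\mathbf Z^S$ is such that a transfer is possible from $s_1\in S$ to $s_2\in S$ ($s_1\ne s_2$) if decreasing the $s_1$-component of $\mathbf x$ by $1$ and increasing its $s_2$-component by $1$ gives another base. Given a total order on $S$, an element $s\in S$ is internally active with respect to $\mathbf x$ if no transfer is possible from $s$ to a smaller element of $S$, and externally active with respect to $\mathbf x$ if no transfer is possible to $s$ from a smaller element of $S$. $\bar\iota(\mathbf x)$ is the number of elements of $S$ that are not internally active with respect to $\mathbf x$, and $\bar\varepsilon(\mathbf x)$ is the number of elements that are not externally active with respect to $\mathbf x$. *)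

theory Defs
  imports "HOL-Library.FuncSet" "HOL-Computational_Algebra.Polynomial"
begin

definition submodular_on :: "'a set \<Rightarrow> ('a set \<Rightarrow> int) \<Rightarrow> bool" where
  "submodular_on S \<mu> \<longleftrightarrow>
    (\<forall>U W. U \<subseteq> S \<longrightarrow> W \<subseteq> S \<longrightarrow> \<mu> U + \<mu> W \<ge> \<mu> (U \<inter> W) + \<mu> (U \<union> W))"

(* The space of real vectors indexed by S is the set extensional S of functions that are
   undefined outside S, so that a vector is determined by its components in S. *)

definition base_polytope :: "'a set \<Rightarrow> ('a set \<Rightarrow> int) \<Rightarrow> ('a \<Rightarrow> real) set" where
  "base_polytope S \<mu> =
    {x \<in> extensional S.
      (\<forall>U. U \<subseteq> S \<longrightarrow> (\<Sum>s\<in>U. x s) \<le> of_int (\<mu> U)) \<and> (\<Sum>s\<in>S. x s) = of_int (\<mu> S)}"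

definition integer_bases :: "'a set \<Rightarrow> ('a set \<Rightarrow> int) \<Rightarrow> ('a \<Rightarrow> real) set" where
  "integer_bases S \<mu> = base_polytope S \<mu> \<inter> (S \<rightarrow>\<^sub>E \<int>)"

definition transfer_possible ::
  "'a set \<Rightarrow> ('a set \<Rightarrow> int) \<Rightarrow> ('a \<Rightarrow> real) \<Rightarrow> 'a \<Rightarrow> 'a \<Rightarrow> bool" where
  "transfer_possible S \<mu> x s1 s2 \<longleftrightarrow>
    s1 \<in> S \<and> s2 \<in> S \<and> s1 \<noteq> s2 \<and> x(s1 := x s1 - 1, s2 := x s2 + 1) \<in> base_polytope S \<mu>"

(* A total order on S is a reflexive relation r with linear_order_on S r;
   (t, s) \<in> r means that t is less than or equal to s. *)

definition internally_active ::
  "'a set \<Rightarrow> ('a set \<Rightarrow> int) \<Rightarrow> 'a rel \<Rightarrow> ('a \<Rightarrow> real) \<Rightarrow> 'a \<Rightarrow> bool" where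
  "internally_active S \<mu> r x s \<longleftrightarrow>
    \<not> (\<exists>t\<in>S. (t, s) \<in> r \<and> t \<noteq> s \<and> transfer_possible S \<mu> x s t)"

definition externally_active ::
  "'a set \<Rightarrow> ('a set \<Rightarrow> int) \<Rightarrow> 'a rel \<Rightarrow> ('a \<Rightarrow> real) \<Rightarrow> 'a \<Rightarrow> bool" where
  "externally_active S \<mu> r x s \<longleftrightarrow>
    \<not> (\<exists>t\<in>S. (t, s) \<in> r \<and> t \<noteq> s \<and> transfer_possible S \<mu> x t s)"

definition internal_inactivity ::
  "'a set \<Rightarrow> ('a set \<Rightarrow> int) \<Rightarrow> 'a rel \<Rightarrow> ('a \<Rightarrow> real) \<Rightarrow> nat" where
  "internal_inactivity S \<mu> r x = card {s \<in> S. \<not> internally_active S \<mu> r x s}"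

definition external_inactivity ::
  "'a set \<Rightarrow> ('a set \<Rightarrow> int) \<Rightarrow> 'a rel \<Rightarrow> ('a \<Rightarrow> real) \<Rightarrow> nat" where
  "external_inactivity S \<mu> r x = card {s \<in> S. \<not> externally_active S \<mu> r x s}"

(* The sums below are genuine finite sums, by finite_integer_bases. *)

definition interior_poly :: "'a set \<Rightarrow> ('a set \<Rightarrow> int) \<Rightarrow> 'a rel \<Rightarrow> int poly" where
  "interior_poly S \<mu> r = (\<Sum>x\<in>integer_bases S \<mu>. monom 1 (internal_inactivity S \<mu> r x))"

definition exterior_poly :: "'a set \<Rightarrow> ('a set \<Rightarrow> int) \<Rightarrow> 'a rel \<Rightarrow> int poly" where
  "exterior_poly S \<mu> r = (\<Sum>x\<in>integer_bases S \<mu>. monom 1 (external_inactivity S \<mu> r x))"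

lemma finite_integer_bases:
  assumes "finite S"
  shows "finite (integer_bases S \<mu>)"
proof (rule finite_subset)
  show "finite (S \<rightarrow>\<^sub>E (\<Union>s\<in>S. real_of_int ` {\<mu> S - \<mu> (S - {s})..\<mu> {s}}))"
    using assms by (intro finite_PiE) auto
  show "integer_bases S \<mu> \<subseteq> (S \<rightarrow>\<^sub>E (\<Union>s\<in>S. real_of_int ` {\<mu> S - \<mu> (S - {s})..\<mu> {s}}))"
  proof
    fix x assume x: "x \<in> integer_bases S \<mu>"
    then have ext: "x \<in> S \<rightarrow>\<^sub>E \<int>"
      and le: "\<And>U. U \<subseteq> S \<Longrightarrow> (\<Sum>s\<in>U. x s) \<le> of_int (\<mu> U)"
      and eq: "(\<Sum>s\<in>S. x s) = of_int (\<mu> S)"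
      by (auto simp: integer_bases_def base_polytope_def)
    have "x s \<in> real_of_int ` {\<mu> S - \<mu> (S - {s})..\<mu> {s}}" if s: "s \<in> S" for s
    proof -
      obtain k where k: "x s = of_int k"
        using ext s by (auto simp: PiE_iff elim: Ints_cases)
      have "x s \<le> of_int (\<mu> {s})" using le[of "{s}"] s by simp
      moreover have "of_int (\<mu> S) = x s + (\<Sum>t\<in>S - {s}. x t)"
        using eq assms s by (simp add: sum.remove)
      moreover have "(\<Sum>t\<in>S - {s}. x t) \<le> of_int (\<mu> (S - {s}))"
        by (rule le) auto
      ultimately have "\<mu> S - \<mu> (S - {s}) \<le> k" "k \<le> \<mu> {s}"
        using k by linarith+
      then show ?thesis using k by auto
    qed
    then show "x \<in> (S \<rightarrow>\<^sub>E (\<Union>s\<in>S. real_of_int ` {\<mu> S - \<mu> (S - {s})..\<mu> {s}}))"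
      using ext by (fastforce simp: PiE_iff)
  qed
qed

end

theory Submission
  imports Defs "HOL-Library.Multiset"
begin

text \<open>
  For an integer base \<open>x\<close>, a transfer from \<open>u\<close> to \<open>v\<close> is possible iff \<open>u\<close> lies in every tight set
  of \<open>x\<close> that contains \<open>v\<close>; in particular this relation is transitive. Tight sets are closed under
  union and intersection, so a transfer from \<open>t\<close> to \<open>s\<close> creates a new possible transfer from \<open>u\<close>
  to \<open>p\<close> only if those from \<open>u\<close> to \<open>s\<close> and from \<open>t\<close> to \<open>p\<close> were possible before.
  Any two orders are linked by transpositions of adjacent elements \<open>s\<close>, \<open>t\<close>. Such a transposition
  changes the inactivity of \<open>x\<close> only if neither \<open>s\<close> nor \<open>t\<close> admits a transfer to the set of
  smaller elements, and then it replaces the contribution of ``\<open>t\<close> to \<open>s\<close> is possible'' by that of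
  ``\<open>s\<close> to \<open>t\<close> is possible''. The transfer from \<open>t\<close> to \<open>s\<close> is a bijection between these
  two kinds of bases, and it preserves the activity of every other element. Reversing all transfers
  exchanges the interior and the exterior polynomial.
\<close>

section \<open>Total orders as lists, and counting inactive elements along a list\<close>

text \<open>The list is read in descending order, below it come the elements of \<open>A\<close>.\<close>

fun inactivity :: "('a \<Rightarrow> 'a \<Rightarrow> bool) \<Rightarrow> 'a set \<Rightarrow> 'a list \<Rightarrow> nat" where
  "inactivity R A [] = 0"
| "inactivity R A (s # ls) = of_bool (\<exists>t \<in> set ls \<union> A. R s t) + inactivity R A ls"

lemma inactivity_append:
  "inactivity R A (xs @ ys) = inactivity R (set ys \<union> A) xs + inactivity R A ys"
  by (induction xs) (auto simp: Un_assoc)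

text \<open>\<open>Q\<close> stands for the set of elements below \<open>u\<close>. Letting it range
  over everything between \<open>A\<close> and \<open>set ls \<union> A\<close> avoids tracking the
  position of \<open>u\<close> in the list.\<close>

lemma inactivity_cong:
  assumes "\<And>u Q. u \<in> set ls \<Longrightarrow> A \<subseteq> Q \<Longrightarrow> Q \<subseteq> set ls \<union> A \<Longrightarrow> (\<exists>t\<in>Q. R u t) \<longleftrightarrow> (\<exists>t\<in>Q. R' u t)"
  shows "inactivity R A ls = inactivity R' A ls"
  using assms
proof (induction ls)
  case (Cons a ls)
  have "(\<exists>t \<in> set ls \<union> A. R a t) \<longleftrightarrow> (\<exists>t \<in> set ls \<union> A. R' a t)"
    by (rule Cons.prems) auto
  moreover have "inactivity R A ls = inactivity R' A ls"
    by (rule Cons.IH, rule Cons.prems) auto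
  ultimately show ?case by simp
qed simp

lemma finite_total_greatest:
  assumes "finite S" "S \<noteq> {}" "trans r" "total_on S r"
  shows "\<exists>m\<in>S. \<forall>t\<in>S. t \<noteq> m \<longrightarrow> (t, m) \<in> r"
  using assms
proof (induction S rule: finite_ne_induct)
  case (insert a S)
  then obtain m where m: "m \<in> S" "\<forall>t\<in>S. t \<noteq> m \<longrightarrow> (t, m) \<in> r"
    by (auto simp: total_on_def)
  have "(a, m) \<in> r \<or> (m, a) \<in> r"
    using insert m by (auto simp: total_on_def)
  then show ?case
    using m insert.prems(1) by (metis insert_iff transD)
qed auto

text \<open>The greatest element becomes the head, and the rest follows by induction.
  \<open>R\<close> is quantified after the list because a single list has to serve the transfer
  relations of all bases.\<close>

lemma total_order_list:
  assumes "finite S" "trans r" "antisym r" "total_on S r"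
  shows "\<exists>ls. distinct ls \<and> set ls = S \<and>
    (\<forall>R. card {s \<in> S. \<exists>t\<in>S. (t, s) \<in> r \<and> t \<noteq> s \<and> R s t} = inactivity R {} ls)"
  using assms(1,4)
proof (induction S rule: finite_psubset_induct)
  case (psubset S)
  show ?case
  proof (cases "S = {}")
    case False
    obtain m where m: "m \<in> S" "\<forall>t\<in>S. t \<noteq> m \<longrightarrow> (t, m) \<in> r"
      using finite_total_greatest[OF psubset.hyps False assms(2) psubset.prems] by blast
    have "S - {m} \<subset> S" "total_on (S - {m}) r"
      using m psubset.prems by (auto simp: total_on_def)
    from psubset.IH[OF this] obtain ls where
      ls: "distinct ls" "set ls = S - {m}" and
      card: "\<And>R. card {s \<in> S - {m}. \<exists>t\<in>S - {m}. (t, s) \<in> r \<and> t \<noteq> s \<and> R s t} = inactivity R {} ls"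
      by auto
    have "card {s \<in> S. \<exists>t\<in>S. (t, s) \<in> r \<and> t \<noteq> s \<and> R s t} = inactivity R {} (m # ls)" for R
    proof -
      let ?X = "{s \<in> S - {m}. \<exists>t\<in>S - {m}. (t, s) \<in> r \<and> t \<noteq> s \<and> R s t}"
      have nle: "(m, s) \<notin> r" if "s \<in> S" "s \<noteq> m" for s
        using that m assms(3) by (auto dest: antisymD)
      have "{s \<in> S. \<exists>t\<in>S. (t, s) \<in> r \<and> t \<noteq> s \<and> R s t}
          = (if \<exists>t\<in>S - {m}. R m t then insert m ?X else ?X)"
        using m nle by auto
      moreover have "finite ?X" "m \<notin> ?X" using psubset.hyps by auto
      ultimately show ?thesis using card[of R] ls(2) by (simp del: Diff_iff)
    qed
    then show ?thesis using ls m(1)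
      by (intro exI[of _ "m # ls"]) auto
  qed (auto intro!: exI[of _ "[]"])
qed

text \<open>The head of \<open>xs\<close> is bubbled to the front of \<open>ys\<close>; induction
  then applies to the tails, with the function \<open>f (a # _)\<close>. Swaps are assumed harmless
  only among rearrangements of \<open>xs\<close>, so that distinctness is at hand where this is
  used.\<close>

lemma adjacent_swaps_imp_permutation_invariant:
  assumes "\<And>us s t vs. mset (us @ s # t # vs) = mset xs \<Longrightarrow> f (us @ s # t # vs) = f (us @ t # s # vs)"
    and "mset ys = mset xs"
  shows "f ys = f xs"
  using assms
proof (induction xs arbitrary: f ys)
  case (Cons a xs)
  have "a \<in> set ys" using Cons.prems(2) by (metis list.set_intros(1) set_mset_mset)
  then obtain us vs where ys: "ys = us @ a # vs" by (meson split_list)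
  have "f (us @ a # vs) = f (a # us @ vs)"
    if "mset (us @ a # vs) = mset (a # xs)" for us vs
    using that
  proof (induction us arbitrary: vs rule: rev_induct)
    case (snoc b us)
    have "f (us @ b # a # vs) = f (us @ a # b # vs)"
      using snoc.prems by (intro Cons.prems(1)) simp
    also have "\<dots> = f (a # us @ b # vs)"
      using snoc.prems by (intro snoc.IH) simp
    finally show ?case by simp
  qed simp
  then have "f ys = f (a # us @ vs)" using ys Cons.prems(2) by simp
  also have "\<dots> = f (a # xs)"
  proof (rule Cons.IH[of "\<lambda>l. f (a # l)"])
    show "mset (us @ vs) = mset xs" using Cons.prems(2) ys by simp
    show "f (a # us @ s # t # vs) = f (a # us @ t # s # vs)"
      if "mset (us @ s # t # vs) = mset xs" for us s t vs
      using Cons.prems(1)[of "a # us" s t vs] that by simp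
  qed
  finally show ?case .
qed simp

section \<open>Abstract transfer systems and invariance under adjacent transpositions\<close>

locale transfer_system =
  fixes B :: "'x set"
    and tr :: "'x \<Rightarrow> 'a \<Rightarrow> 'a \<Rightarrow> bool"
    and mv :: "'a \<Rightarrow> 'a \<Rightarrow> 'x \<Rightarrow> 'x"
  assumes finite_B: "finite B"
    and mv_in: "x \<in> B \<Longrightarrow> tr x u v \<Longrightarrow> mv u v x \<in> B"
    and tr_mv: "x \<in> B \<Longrightarrow> tr x u v \<Longrightarrow> tr (mv u v x) v u"
    and mv_mv: "x \<in> B \<Longrightarrow> tr x u v \<Longrightarrow> mv v u (mv u v x) = x"
    and tr_trans: "x \<in> B \<Longrightarrow> tr x u v \<Longrightarrow> tr x v w \<Longrightarrow> u \<noteq> w \<Longrightarrow> tr x u w"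
    and exchange: "x \<in> B \<Longrightarrow> tr x t s \<Longrightarrow> tr (mv t s x) u p \<Longrightarrow>
      tr x u p \<or> (u = s \<or> tr x u s) \<and> (p = t \<or> tr x t p)"
begin

text \<open>\<open>P\<close> is meant to be the set of elements below both \<open>s\<close> and
  \<open>t\<close>; for bases outside this set, swapping \<open>s\<close> and \<open>t\<close> does
  not change the inactivity.\<close>

definition stuck :: "'a \<Rightarrow> 'a \<Rightarrow> 'a set \<Rightarrow> 'x set" where
  "stuck s t P = {x \<in> B. \<forall>p\<in>P. \<not> tr x s p \<and> \<not> tr x t p}"

lemma stuck_commute: "stuck s t P = stuck t s P"
  by (auto simp: stuck_def)

text \<open>By \<open>exchange\<close>, a new transfer into some \<open>p\<close> in
  \<open>P\<close> would require \<open>p = t\<close> or a transfer from \<open>t\<close> to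
  \<open>p\<close> in \<open>x\<close>; both are excluded.\<close>

lemma mv_stuck:
  assumes "x \<in> stuck s t P" "tr x t s" "t \<notin> P"
  shows "mv t s x \<in> stuck s t P"
proof -
  have x: "x \<in> B" "\<And>p. p \<in> P \<Longrightarrow> \<not> tr x s p \<and> \<not> tr x t p"
    using assms(1) by (auto simp: stuck_def)
  have "\<not> tr (mv t s x) u p" if "p \<in> P" "\<not> tr x u p" for u p
    using exchange[OF x(1) assms(2), of u p] x(2)[OF that(1)] that assms(3) by auto
  then show ?thesis using x mv_in[OF x(1) assms(2)] by (simp add: stuck_def)
qed

lemma mv_inactive_below:
  assumes "x \<in> stuck s t P" "tr x t s" "t \<notin> P" "Q \<subseteq> P" "\<exists>p\<in>Q. tr (mv t s x) u p"
  shows "\<exists>p\<in>Q. tr x u p"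
  using assms exchange unfolding stuck_def by blast

text \<open>By \<open>exchange\<close>, a new transfer from \<open>u\<close> requires that one from
  \<open>u\<close> to \<open>s\<close> was possible before, and \<open>s\<close> itself lies in
  \<open>Q\<close>.\<close>

lemma mv_inactive_above:
  assumes "x \<in> B" "tr x t s" "s \<in> Q" "u \<noteq> s" "\<exists>p\<in>Q. tr (mv t s x) u p"
  shows "\<exists>p\<in>Q. tr x u p"
  using assms exchange by blast

lemma inactivity_mv:
  assumes x: "x \<in> stuck s t (set as)" and tr: "tr x t s"
    and dist: "distinct (bs @ t # s # as)"
  shows "inactivity (tr (mv t s x)) (insert s (insert t (set as))) bs
      = inactivity (tr x) (insert s (insert t (set as))) bs"
    and "inactivity (tr (mv t s x)) {} as = inactivity (tr x) {} as"
proof -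
  let ?y = "mv t s x"
  have xB: "x \<in> B" using x by (auto simp: stuck_def)
  \<comment> \<open>The moved base satisfies the same hypotheses with \<open>s\<close> and
    \<open>t\<close> exchanged, and the reverse move leads back to \<open>x\<close>. The one-sided
    lemmas applied to \<open>?y\<close> thus give the converse implications.\<close>
  have y: "?y \<in> stuck t s (set as)" "?y \<in> B" "tr ?y s t" "mv s t ?y = x"
    using mv_stuck[OF x tr] stuck_commute[of s t] dist mv_in tr_mv mv_mv xB tr by auto
  show "inactivity (tr ?y) (insert s (insert t (set as))) bs
      = inactivity (tr x) (insert s (insert t (set as))) bs"
  proof (rule inactivity_cong)
    fix u Q assume u: "u \<in> set bs" and Q: "insert s (insert t (set as)) \<subseteq> Q"
    then have "s \<in> Q" "t \<in> Q" "u \<noteq> s" "u \<noteq> t" using dist by auto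
    then show "(\<exists>p\<in>Q. tr ?y u p) \<longleftrightarrow> (\<exists>p\<in>Q. tr x u p)"
      using mv_inactive_above[OF xB tr, of Q u] mv_inactive_above[OF y(2,3), of Q u] y(4) by auto
  qed
  show "inactivity (tr ?y) {} as = inactivity (tr x) {} as"
  proof (rule inactivity_cong)
    fix u Q assume Q: "Q \<subseteq> set as \<union> {}"
    then show "(\<exists>p\<in>Q. tr ?y u p) \<longleftrightarrow> (\<exists>p\<in>Q. tr x u p)"
      using mv_inactive_below[OF x tr, of Q u] mv_inactive_below[OF y(1,3), of Q u] y(4) dist by auto
  qed
qed

definition inactivity_poly :: "'a list \<Rightarrow> int poly" where
  "inactivity_poly ls = (\<Sum>x\<in>B. monom 1 (inactivity (tr x) {} ls))"

lemma inactivity_poly_swap: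
  assumes dist: "distinct (bs @ t # s # as)"
  shows "inactivity_poly (bs @ t # s # as) = inactivity_poly (bs @ s # t # as)"
proof -
  define N where "N = stuck s t (set as)"
  \<comment> \<open>\<open>k x\<close> counts the inactive elements other than \<open>s\<close> and
    \<open>t\<close>; it is the same for both lists.\<close>
  define k where "k x = inactivity (tr x) (insert s (insert t (set as))) bs + inactivity (tr x) {} as" for x
  have NB: "N \<subseteq> B" by (auto simp: N_def stuck_def)
  have fN: "finite N" using NB finite_B finite_subset by blast
  have off: "inactivity (tr x) {} (bs @ t # s # as) = inactivity (tr x) {} (bs @ s # t # as)"
    if "x \<in> B - N" for x
  proof -
    have x: "x \<in> B" and ex: "\<exists>p\<in>set as. tr x s p \<or> tr x t p"
      using that by (auto simp: N_def stuck_def)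
    \<comment> \<open>If exactly one of \<open>s\<close>, \<open>t\<close> transfers into
      \<open>as\<close>, then by transitivity the other cannot transfer to it, so together they
      contribute 1 in either order. If both do, they contribute 2.\<close>
    have *: "\<exists>p\<in>set as. tr x t p" if "tr x t s" "\<exists>p\<in>set as. tr x s p"
      using that tr_trans[OF x] dist by (metis distinct.simps(2) distinct_append list.set_intros(2))
    have **: "\<exists>p\<in>set as. tr x s p" if "tr x s t" "\<exists>p\<in>set as. tr x t p"
      using that tr_trans[OF x] dist by (metis distinct.simps(2) distinct_append)
    have "of_bool (\<exists>p\<in>insert s (set as). tr x t p) + of_bool (\<exists>p\<in>set as. tr x s p)
        = (of_bool (\<exists>p\<in>insert t (set as). tr x s p) + of_bool (\<exists>p\<in>set as. tr x t p) :: nat)"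
      using ex * ** by (cases "\<exists>p\<in>set as. tr x s p"; cases "\<exists>p\<in>set as. tr x t p") auto
    then show ?thesis by (simp add: inactivity_append insert_commute)
  qed
  have on: "inactivity (tr x) {} (bs @ t # s # as) = k x + of_bool (tr x t s)"
    "inactivity (tr x) {} (bs @ s # t # as) = k x + of_bool (tr x s t)" if "x \<in> N" for x
    using that unfolding N_def stuck_def k_def
    by (auto simp: inactivity_append insert_commute)
  \<comment> \<open>The first sum does not involve \<open>P\<close>, so only the corrections over
    the bases with \<open>P x\<close> remain to be compared, and these depend on \<open>x\<close>
    through \<open>k x\<close> alone.\<close>
  have split: "(\<Sum>x\<in>N. monom 1 (k x + of_bool (P x)))
      = (\<Sum>x\<in>N. monom 1 (k x)) + (\<Sum>x\<in>{x \<in> N. P x}. monom 1 (k x + 1) - monom (1::int) (k x))" for P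
  proof -
    have "(\<Sum>x\<in>N. monom (1::int) (k x + of_bool (P x)))
        = (\<Sum>x\<in>N. monom 1 (k x) + (if P x then monom 1 (k x + 1) - monom 1 (k x) else 0))"
      by (rule sum.cong) auto
    also have "\<dots> = (\<Sum>x\<in>N. monom 1 (k x))
        + (\<Sum>x\<in>N. if P x then monom 1 (k x + 1) - monom 1 (k x) else 0)"
      by (rule sum.distrib)
    finally show ?thesis using fN by (simp only: sum.inter_filter)
  qed
  have "(\<Sum>x\<in>{x \<in> N. tr x t s}. monom 1 (k x + 1) - monom (1::int) (k x))
      = (\<Sum>x\<in>{x \<in> N. tr x s t}. monom 1 (k x + 1) - monom 1 (k x))"
  proof (rule sum.reindex_bij_witness[where i = "mv s t" and j = "mv t s"])
    fix x assume "x \<in> {x \<in> N. tr x t s}"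
    then have x: "x \<in> N" "x \<in> B" "tr x t s" using NB by auto
    then show "mv s t (mv t s x) = x" by (auto intro: mv_mv)
    show "mv t s x \<in> {x \<in> N. tr x s t}"
      using x mv_stuck[of x s t "set as"] tr_mv dist by (auto simp: N_def)
    have "k (mv t s x) = k x"
      using inactivity_mv[OF _ x(3) dist] x(1) by (simp add: k_def N_def)
    then show "monom 1 (k (mv t s x) + 1) - monom 1 (k (mv t s x))
        = monom 1 (k x + 1) - monom (1::int) (k x)" by simp
  next
    fix x assume "x \<in> {x \<in> N. tr x s t}"
    then have x: "x \<in> N" "x \<in> B" "tr x s t" using NB by auto
    then show "mv t s (mv s t x) = x" by (auto intro: mv_mv)
    show "mv s t x \<in> {x \<in> N. tr x t s}"
      using x mv_stuck[of x t s "set as"] tr_mv dist stuck_commute[of s t] by (auto simp: N_def)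
  qed
  then have "(\<Sum>x\<in>N. monom (1::int) (k x + of_bool (tr x t s)))
      = (\<Sum>x\<in>N. monom 1 (k x + of_bool (tr x s t)))"
    by (simp only: split)
  then have "(\<Sum>x\<in>N. monom (1::int) (inactivity (tr x) {} (bs @ t # s # as)))
      = (\<Sum>x\<in>N. monom 1 (inactivity (tr x) {} (bs @ s # t # as)))"
    by (simp add: on del: of_bool_eq cong: sum.cong)
  moreover have "(\<Sum>x\<in>B - N. monom (1::int) (inactivity (tr x) {} (bs @ t # s # as)))
      = (\<Sum>x\<in>B - N. monom 1 (inactivity (tr x) {} (bs @ s # t # as)))"
    by (intro sum.cong refl) (simp only: off)
  ultimately show ?thesis
    unfolding inactivity_poly_def by (simp only: sum.subset_diff[OF NB finite_B])
qed

lemma inactivity_poly_permute: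
  assumes "distinct xs" "distinct ys" "set ys = set xs"
  shows "inactivity_poly ys = inactivity_poly xs"
proof (rule adjacent_swaps_imp_permutation_invariant)
  show "mset ys = mset xs" using assms set_eq_iff_mset_eq_distinct by blast
  fix us s t vs assume "mset (us @ s # t # vs) = mset xs"
  then have "distinct (us @ s # t # vs)" using assms(1) mset_eq_imp_distinct_iff by blast
  then show "inactivity_poly (us @ s # t # vs) = inactivity_poly (us @ t # s # vs)"
    by (rule inactivity_poly_swap)
qed

lemma order_independent:
  assumes "finite S" "linear_order_on S r" "linear_order_on S r'"
  shows "(\<Sum>x\<in>B. monom (1::int) (card {s \<in> S. \<exists>t\<in>S. (t, s) \<in> r \<and> t \<noteq> s \<and> tr x s t}))
    = (\<Sum>x\<in>B. monom 1 (card {s \<in> S. \<exists>t\<in>S. (t, s) \<in> r' \<and> t \<noteq> s \<and> tr x s t}))"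
proof -
  have "\<exists>ls. distinct ls \<and> set ls = S \<and>
    (\<forall>R. card {s \<in> S. \<exists>t\<in>S. (t, s) \<in> q \<and> t \<noteq> s \<and> R s t} = inactivity R {} ls)"
    if "linear_order_on S q" for q
    using that assms(1) unfolding linear_order_on_def partial_order_on_def preorder_on_def
    by (intro total_order_list) auto
  from this[OF assms(2)] this[OF assms(3)] obtain xs ys where
    "distinct xs" "set xs = S" "distinct ys" "set ys = S" and
    card: "\<And>R. card {s \<in> S. \<exists>t\<in>S. (t, s) \<in> r \<and> t \<noteq> s \<and> R s t} = inactivity R {} xs"
      "\<And>R. card {s \<in> S. \<exists>t\<in>S. (t, s) \<in> r' \<and> t \<noteq> s \<and> R s t} = inactivity R {} ys"
    by (elim exE conjE) metis
  then have "inactivity_poly xs = inactivity_poly ys"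
    by (intro inactivity_poly_permute) auto
  then show ?thesis unfolding inactivity_poly_def card .
qed

text \<open>The axioms are self-dual: exchanging \<open>s\<close> with \<open>t\<close> and
  \<open>u\<close> with \<open>p\<close> interchanges the two conjuncts in
  \<open>exchange\<close>.\<close>

lemma reverse: "transfer_system B (\<lambda>x u v. tr x v u) (\<lambda>u v. mv v u)"
proof
  show "x \<in> B \<Longrightarrow> tr x s t \<Longrightarrow> tr (mv s t x) p u \<Longrightarrow>
      tr x p u \<or> (u = s \<or> tr x s u) \<and> (p = t \<or> tr x p t)" for x s t u p
    using exchange[of x s t p u] by blast
qed (auto intro: finite_B mv_in tr_mv mv_mv tr_trans)

end

section \<open>Tight sets and transfers between integer bases\<close>

definition tight :: "'a set \<Rightarrow> ('a set \<Rightarrow> int) \<Rightarrow> ('a \<Rightarrow> real) \<Rightarrow> 'a set \<Rightarrow> bool" where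
  "tight S \<mu> x U \<longleftrightarrow> U \<subseteq> S \<and> sum x U = of_int (\<mu> U)"

definition transfer :: "'a \<Rightarrow> 'a \<Rightarrow> ('a \<Rightarrow> real) \<Rightarrow> 'a \<Rightarrow> real" where
  "transfer u v x = x(u := x u - 1, v := x v + 1)"

lemma sum_transfer:
  assumes "finite U" "u \<noteq> v"
  shows "sum (transfer u v x) U = sum x U + of_bool (v \<in> U) - of_bool (u \<in> U)"
proof -
  have "sum (transfer u v x) U
      = (\<Sum>s\<in>U. x s + (if s = v then 1 else 0) - (if s = u then 1 else 0))"
    using assms(2) by (intro sum.cong) (auto simp: transfer_def)
  then show ?thesis using assms(1) by (simp add: sum.distrib sum_subtractf)
qed

text \<open>The sums over union and intersection add up to \<open>\<mu> U + \<mu> W\<close>, which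
  by submodularity is at least the sum of their upper bounds; hence both bounds are
  attained.\<close>

lemma tight_Un_Int:
  assumes "finite S" "submodular_on S \<mu>" "x \<in> base_polytope S \<mu>" "tight S \<mu> x U" "tight S \<mu> x W"
  shows "tight S \<mu> x (U \<union> W)" "tight S \<mu> x (U \<inter> W)"
proof -
  have UW: "U \<subseteq> S" "W \<subseteq> S" using assms by (auto simp: tight_def)
  then have "sum x (U \<union> W) + sum x (U \<inter> W) = sum x U + sum x W"
    using assms(1) by (intro sum.union_inter) (auto dest: finite_subset)
  moreover have "sum x (U \<union> W) \<le> of_int (\<mu> (U \<union> W))" "sum x (U \<inter> W) \<le> of_int (\<mu> (U \<inter> W))"
    using assms(3) UW by (simp_all add: base_polytope_def le_infI1)
  moreover have "real_of_int (\<mu> U + \<mu> W) \<ge> of_int (\<mu> (U \<inter> W) + \<mu> (U \<union> W))"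
    using assms(2) UW by (simp only: submodular_on_def of_int_le_iff)
  ultimately show "tight S \<mu> x (U \<union> W)" "tight S \<mu> x (U \<inter> W)"
    using assms(4,5) UW by (auto simp: tight_def)
qed

text \<open>The transfer raises the sum by 1 exactly on the sets that contain \<open>v\<close> but
  not \<open>u\<close>, so only tight sets of this kind can block it.\<close>

lemma transfer_possible_iff:
  assumes "finite S" "x \<in> integer_bases S \<mu>"
  shows "transfer_possible S \<mu> x u v \<longleftrightarrow>
    u \<in> S \<and> v \<in> S \<and> u \<noteq> v \<and> (\<forall>U. tight S \<mu> x U \<longrightarrow> v \<in> U \<longrightarrow> u \<in> U)"
proof (cases "u \<in> S \<and> v \<in> S \<and> u \<noteq> v")
  case True
  have x: "x \<in> extensional S" "\<And>U. U \<subseteq> S \<Longrightarrow> sum x U \<le> of_int (\<mu> U)" "sum x S = of_int (\<mu> S)"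
    "\<And>s. s \<in> S \<Longrightarrow> x s \<in> \<int>"
    using assms(2) by (auto simp: integer_bases_def base_polytope_def)
  have sum: "sum (transfer u v x) U = sum x U + of_bool (v \<in> U) - of_bool (u \<in> U)" if "U \<subseteq> S" for U
    using True finite_subset[OF that assms(1)] by (intro sum_transfer) auto
  \<comment> \<open>Integrality enters here: a set that is not tight has slack at least 1.\<close>
  have slack: "sum x U + 1 \<le> of_int (\<mu> U) \<longleftrightarrow> \<not> tight S \<mu> x U" if "U \<subseteq> S" for U
  proof -
    have "sum x U \<in> \<int>" using that x(4) by (intro Ints_sum) auto
    then obtain n where "sum x U = of_int n" by (elim Ints_cases)
    then show ?thesis using x(2)[OF that] that by (auto simp: tight_def)
  qed
  have ext: "transfer u v x \<in> extensional S"
    using x(1) True by (auto simp: transfer_def extensional_def)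
  have "transfer u v x \<in> base_polytope S \<mu> \<longleftrightarrow>
      (\<forall>U\<subseteq>S. sum x U + of_bool (v \<in> U) - of_bool (u \<in> U) \<le> of_int (\<mu> U))"
    using ext sum x(3) True by (auto simp: base_polytope_def)
  also have "\<dots> \<longleftrightarrow> (\<forall>U. tight S \<mu> x U \<longrightarrow> v \<in> U \<longrightarrow> u \<in> U)"
  proof (intro iffI allI impI)
    fix U assume *: "\<forall>U\<subseteq>S. sum x U + of_bool (v \<in> U) - of_bool (u \<in> U) \<le> of_int (\<mu> U)"
      "tight S \<mu> x U" "v \<in> U"
    then have "U \<subseteq> S" "sum x U = of_int (\<mu> U)" by (auto simp: tight_def)
    with *(1) have "of_int (\<mu> U) + of_bool (v \<in> U) - of_bool (u \<in> U) \<le> real_of_int (\<mu> U)"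
      by metis
    then show "u \<in> U" using *(3) by (cases "u \<in> U") auto
  next
    fix U assume *: "\<forall>U. tight S \<mu> x U \<longrightarrow> v \<in> U \<longrightarrow> u \<in> U" "U \<subseteq> S"
    show "sum x U + of_bool (v \<in> U) - of_bool (u \<in> U) \<le> of_int (\<mu> U)"
      using * slack[of U] x(2)[of U] by (cases "u \<in> U"; cases "v \<in> U") auto
  qed
  finally show ?thesis using True by (auto simp: transfer_possible_def transfer_def)
qed (auto simp: transfer_possible_def)

lemma transfer_transfer: "u \<noteq> v \<Longrightarrow> transfer v u (transfer u v x) = x"
  by (auto simp: transfer_def)

lemma transfer_integer_bases:
  assumes "x \<in> integer_bases S \<mu>" "transfer_possible S \<mu> x u v"
  shows "transfer u v x \<in> integer_bases S \<mu>"
  using assms by (auto simp: integer_bases_def transfer_possible_def transfer_def PiE_iff extensional_def)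

lemma transfer_possible_back:
  assumes "x \<in> integer_bases S \<mu>" "transfer_possible S \<mu> x u v"
  shows "transfer_possible S \<mu> (transfer u v x) v u"
  using assms transfer_transfer[of u v x]
  by (auto simp: transfer_possible_def integer_bases_def transfer_def)

lemma transfer_possible_exchange:
  assumes S: "finite S" "submodular_on S \<mu>" and x: "x \<in> integer_bases S \<mu>"
    and ts: "transfer_possible S \<mu> x t s"
    and up: "transfer_possible S \<mu> (transfer t s x) u p"
  shows "transfer_possible S \<mu> x u p \<or>
    (u = s \<or> transfer_possible S \<mu> x u s) \<and> (p = t \<or> transfer_possible S \<mu> x t p)"
proof (rule disjCI)
  have y: "transfer t s x \<in> integer_bases S \<mu>"
    using transfer_integer_bases[OF x ts] .
  note tp = transfer_possible_iff[OF S(1) x] and tpy = transfer_possible_iff[OF S(1) y]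
  have xB: "x \<in> base_polytope S \<mu>" using x by (simp add: integer_bases_def)
  have in_S: "u \<in> S" "p \<in> S" "u \<noteq> p" "s \<in> S" "t \<in> S" "t \<noteq> s" using up ts by (auto simp: tp tpy)
  \<comment> \<open>A tight set blocking the transfer from \<open>u\<close> to \<open>p\<close> must
    lose its tightness under the move, so it contains exactly one of \<open>s\<close> and
    \<open>t\<close>. This is \<open>t\<close>, since the transfer from \<open>t\<close> to
    \<open>s\<close> is possible for \<open>x\<close>.\<close>
  have key: "t \<in> U \<and> s \<notin> U" if "tight S \<mu> x U" "p \<in> U" "u \<notin> U" for U
  proof -
    have "\<not> tight S \<mu> (transfer t s x) U" using up that by (auto simp: tpy)
    then have "(s \<in> U) \<noteq> (t \<in> U)"
      using that(1) sum_transfer[of U t s x] in_S finite_subset[OF _ S(1)] by (auto simp: tight_def)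
    then show ?thesis using ts that(1) by (auto simp: tp)
  qed
  assume "\<not> ((u = s \<or> transfer_possible S \<mu> x u s) \<and> (p = t \<or> transfer_possible S \<mu> x t p))"
  then consider V where "tight S \<mu> x V" "s \<in> V" "u \<notin> V" | V where "tight S \<mu> x V" "p \<in> V" "t \<notin> V"
    using in_S by (auto simp: tp)
  then show "transfer_possible S \<mu> x u p"
  proof cases
    case 1
    \<comment> \<open>If \<open>U\<close> blocked the transfer, so would the tight set
      \<open>U \<union> V\<close>, which contains \<open>s\<close>, contrary to
      \<open>key\<close>.\<close>
    have "u \<in> U" if "tight S \<mu> x U" "p \<in> U" for U
      using key[OF tight_Un_Int(1)[OF S xB that(1) 1(1)]] that 1 by blast
    then show ?thesis using in_S by (simp add: tp)
  next
    case 2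
    \<comment> \<open>Dually, \<open>U \<inter> V\<close> would be a blocking tight set without
      \<open>t\<close>.\<close>
    have "u \<in> U" if "tight S \<mu> x U" "p \<in> U" for U
      using key[OF tight_Un_Int(2)[OF S xB that(1) 2(1)]] that 2 by blast
    then show ?thesis using in_S by (simp add: tp)
  qed
qed

lemma transfer_system_integer_bases:
  assumes "finite S" "submodular_on S \<mu>"
  shows "transfer_system (integer_bases S \<mu>) (transfer_possible S \<mu>) transfer"
proof
  show "transfer v u (transfer u v x) = x" if "transfer_possible S \<mu> x u v" for x u v
    using that by (intro transfer_transfer) (auto simp: transfer_possible_def)
  show "transfer_possible S \<mu> x u w"
    if "x \<in> integer_bases S \<mu>" "transfer_possible S \<mu> x u v" "transfer_possible S \<mu> x v w" "u \<noteq> w"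
    for x u v w
    using that by (simp add: transfer_possible_iff[OF assms(1)])
qed (fact finite_integer_bases[OF assms(1)] transfer_integer_bases transfer_possible_back
    transfer_possible_exchange[OF assms])+

theorem mainTheorem4:
  fixes S :: "'a set" and \<mu> :: "'a set \<Rightarrow> int" and r r' :: "'a rel"
  assumes "finite S"
    and "submodular_on S \<mu>"
    and "linear_order_on S r"
    and "linear_order_on S r'"
  shows "interior_poly S \<mu> r = interior_poly S \<mu> r' \<and> exterior_poly S \<mu> r = exterior_poly S \<mu> r'"
proof -
  interpret int: transfer_system "integer_bases S \<mu>" "transfer_possible S \<mu>" transfer
    using assms(1,2) by (rule transfer_system_integer_bases)
  interpret ext: transfer_system "integer_bases S \<mu>" "\<lambda>x u v. transfer_possible S \<mu> x v u"
    "\<lambda>u v. transfer v u"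
    by (rule int.reverse)
  show ?thesis
    using int.order_independent[OF assms(1,3,4)] ext.order_independent[OF assms(1,3,4)]
    by (simp add: interior_poly_def exterior_poly_def internal_inactivity_def
        external_inactivity_def internally_active_def externally_active_def)
qed

end
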